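(* Let $R$ be an integral domain of finite character and let $I$ be an invertible ideal of $R$. Then $I$ is generated by an idempotent pair, i.e. there is an idempotent pair $a,b\in R$ with $I=\langle a,b\rangle$.
   Context: Two elements $a,b$ of an integral domain $R$ form an idempotent pair if either $a(1-a)\in bR$ or $b(1-b)\in aR$. $\langle a,b\rangle$ denotes the ideal generated by $a$ and $b$. An integral domain is of finite character if each of its non-zero elements is contained in only finitely many maximal ideals. *)

theory Defs
  imports "HOL-Computational_Algebra.Computational_Algebra"
begin

text \<open>The integral domain \<open>R\<close> is a type \<^typ>\<open>'a::idom\<close>, and its quotient field is
  \<^typ>\<open>'a fract\<close>, into which \<open>R\<close> is embedded by \<^const>\<open>to_fract\<close>.
  Ideals of \<open>R\<close> are the submodules of \<open>R\<close> regarded as a module over itself. The locale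
  \<^locale>\<open>module\<close> is not interpreted globally for multiplication, because its simp rule
  \<open>scale_scale\<close> would reassociate all products.\<close>

lemma module_ring: "module ((*) :: 'a::comm_ring_1 \<Rightarrow> 'a \<Rightarrow> 'a)"
  by unfold_locales (simp_all add: algebra_simps)

definition is_ideal :: "'a::comm_ring_1 set \<Rightarrow> bool" where
  "is_ideal = module.subspace (*)"

definition ideal_generated :: "'a::comm_ring_1 set \<Rightarrow> 'a set" where
  "ideal_generated = module.span (*)"

lemma is_ideal_iff:
  "is_ideal I \<longleftrightarrow> 0 \<in> I \<and> (\<forall>x\<in>I. \<forall>y\<in>I. x + y \<in> I) \<and> (\<forall>r. \<forall>x\<in>I. r * x \<in> I)"
  by (auto simp: is_ideal_def module.subspace_def[OF module_ring])

lemma ideal_generated_pair: "ideal_generated {a, b} = {r * a + s * b |r s. True}"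
proof -
  have *: "x - r * a = s * b \<longleftrightarrow> x = r * a + s * b" for x r s
    by (auto simp: algebra_simps)
  show ?thesis
    by (simp add: ideal_generated_def module.span_insert[OF module_ring]
        module.span_empty[OF module_ring] *)
qed

definition is_maximal_ideal :: "'a::comm_ring_1 set \<Rightarrow> bool" where
  "is_maximal_ideal M \<longleftrightarrow>
     is_ideal M \<and> M \<noteq> UNIV \<and> (\<forall>J. is_ideal J \<and> M \<subseteq> J \<longrightarrow> J = M \<or> J = UNIV)"

definition finite_character :: "'a::idom itself \<Rightarrow> bool" where
  "finite_character _ \<longleftrightarrow> (\<forall>x::'a. x \<noteq> 0 \<longrightarrow> finite {M. is_maximal_ideal M \<and> x \<in> M})"

definition idempotent_pair :: "'a::idom \<Rightarrow> 'a \<Rightarrow> bool" where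
  "idempotent_pair a b \<longleftrightarrow> a * (1 - a) \<in> range ((*) b) \<or> b * (1 - b) \<in> range ((*) a)"

definition fract_scale :: "'a::idom \<Rightarrow> 'a fract \<Rightarrow> 'a fract" where
  "fract_scale r x = to_fract r * x"

lemma module_fract: "module (fract_scale :: 'a::idom \<Rightarrow> 'a fract \<Rightarrow> 'a fract)"
  by unfold_locales (simp_all add: fract_scale_def algebra_simps)

text \<open>A fractional ideal is not required to be non-zero; this makes no difference to invertibility,
  as a factor of \<open>R\<close> cannot be zero.\<close>

definition is_fractional_ideal :: "'a::idom fract set \<Rightarrow> bool" where
  "is_fractional_ideal J \<longleftrightarrow>
     module.subspace fract_scale J \<and>
     (\<exists>d. d \<noteq> 0 \<and> (\<forall>x\<in>J. fract_scale d x \<in> range to_fract))"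

definition fractional_ideal_prod :: "'a::idom fract set \<Rightarrow> 'a fract set \<Rightarrow> 'a fract set" where
  "fractional_ideal_prod I J = module.span fract_scale {x * y |x y. x \<in> I \<and> y \<in> J}"

definition is_invertible_ideal :: "'a::idom set \<Rightarrow> bool" where
  "is_invertible_ideal I \<longleftrightarrow>
     is_ideal I \<and>
     (\<exists>J. is_fractional_ideal J \<and> fractional_ideal_prod (to_fract ` I) J = range to_fract)"

end

(* Write J for the inverse of I. If b \<in> I is such that the ideal L = bJ of R is comaximal with I, choose
   a \<in> I with 1 - a \<in> L. As IL = bR, this gives a(1 - a) \<in> bR and I \<subseteq> aI + (1 - a)I \<subseteq> aR + bR.
   The condition on b is that bJ lies in no maximal ideal containing I; by finite character there
   are only finitely many of these, and b is corrected at one of them at a time. *)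
theory Submission
  imports Defs
begin

lemma is_ideal_diff:
  assumes "is_ideal I" "x \<in> I" "y \<in> I"
  shows "x - y \<in> I"
proof -
  have "x + (-1) * y \<in> I" using assms unfolding is_ideal_iff by blast
  then show ?thesis by simp
qed

lemma is_ideal_UNIV_iff: "is_ideal I \<Longrightarrow> I = UNIV \<longleftrightarrow> 1 \<in> I"
  by (metis UNIV_I UNIV_eq_I is_ideal_iff mult.right_neutral)

lemma is_ideal_sum:
  assumes "is_ideal I" "is_ideal J"
  shows "is_ideal {x + y |x y. x \<in> I \<and> y \<in> J}"
proof -
  have "0 \<in> {x + y |x y. x \<in> I \<and> y \<in> J}"
    using assms unfolding is_ideal_iff by force
  moreover have "(x + y) + (x' + y') \<in> {x + y |x y. x \<in> I \<and> y \<in> J}"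
    if "x \<in> I" "y \<in> J" "x' \<in> I" "y' \<in> J" for x y x' y'
  proof -
    have "(x + y) + (x' + y') = (x + x') + (y + y')" by (simp add: algebra_simps)
    with that assms show ?thesis unfolding is_ideal_iff by blast
  qed
  moreover have "r * (x + y) \<in> {x + y |x y. x \<in> I \<and> y \<in> J}"
    if "x \<in> I" "y \<in> J" for r x y
    using that assms unfolding is_ideal_iff distrib_left by blast
  ultimately show ?thesis unfolding is_ideal_iff by blast
qed

text \<open>Zorn's lemma, applied to the ideals that contain \<open>I\<close> and omit 1. Omitting 1
  is equivalent to being proper, and in this form properness visibly passes to unions of
  chains.\<close>

lemma exists_maximal_ideal:
  assumes "is_ideal I" "I \<noteq> UNIV"
  obtains M where "is_maximal_ideal M" "I \<subseteq> M"
proof -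
  define A where "A = {K. is_ideal K \<and> 1 \<notin> K \<and> I \<subseteq> K}"
  have "I \<in> A" using assms is_ideal_UNIV_iff by (auto simp: A_def)
  have "\<Union>C \<in> A" if "C \<noteq> {}" and chain: "subset.chain A C" for C
  proof -
    have C: "is_ideal K" "1 \<notin> K" "I \<subseteq> K" if "K \<in> C" for K
      using chain that by (auto simp: subset.chain_def A_def)
    have "x + y \<in> \<Union>C" if x: "x \<in> X" "X \<in> C" and y: "y \<in> Y" "Y \<in> C" for x y X Y
    proof -
      have "X \<subseteq> Y \<or> Y \<subseteq> X" using chain x y unfolding subset.chain_def by blast
      then obtain K where "K \<in> C" "x \<in> K" "y \<in> K" using x y by blast
      then show ?thesis using C(1)[of K] unfolding is_ideal_iff by blast
    qed
    moreover have "0 \<in> \<Union>C" using C(1) \<open>C \<noteq> {}\<close> unfolding is_ideal_iff by blast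
    moreover have "r * x \<in> \<Union>C" if "x \<in> \<Union>C" for r x
      using C(1) that unfolding is_ideal_iff by blast
    ultimately have "is_ideal (\<Union>C)" unfolding is_ideal_iff by blast
    then show ?thesis using C \<open>C \<noteq> {}\<close> unfolding A_def by blast
  qed
  then obtain M where M: "M \<in> A" and max: "\<And>K. K \<in> A \<Longrightarrow> M \<subseteq> K \<Longrightarrow> K = M"
    using subset_Zorn_nonempty[of A] \<open>I \<in> A\<close> by blast
  have "is_maximal_ideal M"
    unfolding is_maximal_ideal_def
  proof (intro conjI allI impI)
    show "is_ideal M" "M \<noteq> UNIV" using M by (auto simp: A_def)
    show "K = M \<or> K = UNIV" if "is_ideal K \<and> M \<subseteq> K" for K
      using that M max[of K] is_ideal_UNIV_iff[of K] unfolding A_def by blast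
  qed
  with M that show thesis by (auto simp: A_def)
qed

text \<open>Since \<open>x\<close> lies outside \<open>M\<close>, the ideal M + xR is the whole
  ring, so 1 = m + xr. Multiplying by \<open>y\<close> puts \<open>y\<close> in
  \<open>M\<close>.\<close>

lemma maximal_ideal_prime:
  assumes M: "is_maximal_ideal M" and "x * y \<in> M" "x \<notin> M"
  shows "y \<in> M"
proof -
  have ideal: "is_ideal M" using M by (simp add: is_maximal_ideal_def)
  define K where "K = {m + z |m z. m \<in> M \<and> z \<in> range ((*) x)}"
  have "0 \<in> range ((*) x)" by (metis mult_zero_right rangeI)
  moreover have "x * r + x * s \<in> range ((*) x)" "t * (x * r) \<in> range ((*) x)" for r s t
    by (metis distrib_left rangeI, metis mult.left_commute rangeI)
  ultimately have "is_ideal (range ((*) x))"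
    unfolding is_ideal_iff by blast
  then have "is_ideal K" unfolding K_def using ideal is_ideal_sum by blast
  moreover have "M \<subseteq> K" unfolding K_def using \<open>0 \<in> range ((*) x)\<close> by force
  moreover have "x \<in> K"
  proof -
    have "0 \<in> M" using ideal by (simp add: is_ideal_iff)
    moreover have "x = 0 + x * 1" by simp
    ultimately show ?thesis unfolding K_def by blast
  qed
  ultimately have "1 \<in> K" using M \<open>x \<notin> M\<close> unfolding is_maximal_ideal_def by blast
  then obtain m r where m: "m \<in> M" "1 = m + x * r" unfolding K_def by blast
  then have "y = y * m + r * (x * y)"
    by (metis distrib_left mult.commute mult.left_commute mult.right_neutral)
  moreover have "y * m + r * (x * y) \<in> M"
    using ideal m \<open>x * y \<in> M\<close> unfolding is_ideal_iff by blast
  ultimately show ?thesis by simp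
qed

text \<open>A product of elements \<open>c\<close>, one from each \<open>N\<close> in
  \<open>F\<close> and none in \<open>M\<close>, will do: such \<open>c\<close> exist because
  distinct maximal ideals are incomparable, and their product stays outside \<open>M\<close> because
  \<open>M\<close> is prime. This \<open>e\<close> allows a change at \<open>M\<close> that is
  invisible modulo the members of \<open>F\<close>.\<close>

lemma maximal_ideals_avoid:
  assumes "finite F" and F: "\<And>N. N \<in> F \<Longrightarrow> is_maximal_ideal N"
    and M: "is_maximal_ideal M" "M \<notin> F"
  shows "\<exists>e. e \<notin> M \<and> (\<forall>N\<in>F. e \<in> N)"
  using \<open>finite F\<close> F M(2)
proof (induction F)
  case empty
  then show ?case using M(1) unfolding is_maximal_ideal_def by blast
next
  case (insert N F)
  then obtain e where e: "e \<notin> M" "\<forall>N\<in>F. e \<in> N" by auto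
  obtain c where c: "c \<in> N" "c \<notin> M"
    using insert.prems M(1) unfolding is_maximal_ideal_def by blast
  have "e * c \<notin> M" using maximal_ideal_prime[OF M(1)] e(1) c(2) by blast
  moreover have "e * c \<in> K" if "K \<in> insert N F" for K
  proof -
    have "is_ideal K" using insert.prems that by (simp add: is_maximal_ideal_def)
    then have "u * v \<in> K" "v * u \<in> K" if "v \<in> K" for u v
      using that unfolding is_ideal_iff by (auto simp: mult.commute)
    with that e c show ?thesis by blast
  qed
  ultimately show ?case by blast
qed

text \<open>Turns IJ = R into two statements about single products, so that spans need not be
  handled later. Products lie in \<open>R\<close>; and if all of them lay in a proper ideal
  \<open>M\<close>, so would their span, which is \<open>R\<close>.\<close>

lemma invertible_idealE:
  fixes I :: "'a::idom set"
  assumes "is_invertible_ideal I"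
  obtains J where "is_ideal I" "module.subspace fract_scale J"
    "\<And>x y. x \<in> I \<Longrightarrow> y \<in> J \<Longrightarrow> to_fract x * y \<in> range to_fract"
    "\<And>M. is_ideal M \<Longrightarrow> M \<noteq> UNIV \<Longrightarrow> \<exists>x\<in>I. \<exists>y\<in>J. to_fract x * y \<notin> to_fract ` M"
proof -
  interpret module "fract_scale :: 'a \<Rightarrow> 'a fract \<Rightarrow> 'a fract" by (rule module_fract)
  from assms obtain J where ideal: "is_ideal I" and J: "subspace J"
    and prod: "span {x * y |x y. x \<in> to_fract ` I \<and> y \<in> J} = range to_fract"
    unfolding is_invertible_ideal_def is_fractional_ideal_def fractional_ideal_prod_def by blast
  have "to_fract x * y \<in> range to_fract" if "x \<in> I" "y \<in> J" for x y
    unfolding prod[symmetric] using that by (intro span_base) blast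
  moreover have "\<exists>x\<in>I. \<exists>y\<in>J. to_fract x * y \<notin> to_fract ` M"
    if M: "is_ideal M" "M \<noteq> UNIV" for M
  proof (rule ccontr)
    assume "\<not> ?thesis"
    moreover have "subspace (to_fract ` M)"
      unfolding subspace_def fract_scale_def
      using M(1) unfolding is_ideal_iff
      by (auto simp flip: to_fract_add to_fract_mult)
    ultimately have "range to_fract \<subseteq> to_fract ` M"
      unfolding prod[symmetric] by (intro span_minimal) auto
    then have "1 \<in> M" by (metis imageE rangeI subsetD to_fract_eq_iff)
    with M show False using is_ideal_UNIV_iff by blast
  qed
  ultimately show thesis using that ideal J by blast
qed

theorem corollary1p6:
  fixes I :: "'a::idom set"
  assumes "finite_character TYPE('a)"
    and "is_invertible_ideal I"
  shows "\<exists>a b. idempotent_pair a b \<and> I = ideal_generated {a, b}"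
proof -
  from assms(2) obtain J where I: "is_ideal I" and J: "module.subspace fract_scale J"
    and IJ: "\<And>x y. x \<in> I \<Longrightarrow> y \<in> J \<Longrightarrow> to_fract x * y \<in> range to_fract"
    and IJ_proper: "\<And>M. is_ideal M \<Longrightarrow> M \<noteq> UNIV \<Longrightarrow>
      \<exists>x\<in>I. \<exists>y\<in>J. to_fract x * y \<notin> to_fract ` M"
    using invertible_idealE by blast
  have J0: "0 \<in> J" and J_add: "\<And>y z. y \<in> J \<Longrightarrow> z \<in> J \<Longrightarrow> y + z \<in> J"
    and J_scale: "\<And>r y. y \<in> J \<Longrightarrow> to_fract r * y \<in> J"
    using J by (auto simp: module.subspace_def[OF module_fract] fract_scale_def)

  have fin: "finite {M. is_maximal_ideal M \<and> I \<subseteq> M}"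
  proof -
    \<comment> \<open>The zero ideal is proper, so some product from \<open>I\<close> and
      \<open>J\<close> is non-zero. This supplies a non-zero \<open>x\<close> in \<open>I\<close>,
      and every maximal ideal containing \<open>I\<close> contains \<open>x\<close>.\<close>
    have "is_ideal {0::'a}" by (simp add: is_ideal_iff)
    moreover have "{0::'a} \<noteq> UNIV" by (metis UNIV_I singletonD zero_neq_one)
    ultimately obtain x y where "x \<in> I" "to_fract x * y \<notin> to_fract ` {0}"
      using IJ_proper by blast
    then have "x \<noteq> 0" by auto
    then have "finite {M. is_maximal_ideal M \<and> x \<in> M}"
      using assms(1) by (simp add: finite_character_def)
    then show ?thesis by (rule finite_subset[rotated]) (use \<open>x \<in> I\<close> in auto)
  qed

  \<comment> \<open>Stated for an arbitrary finite set \<open>F\<close> of maximal ideals so that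
    induction applies; it is used for those containing \<open>I\<close>. The condition says that bJ
    is not contained in \<open>M\<close>.\<close>
  have "\<exists>b\<in>I. \<forall>M\<in>F. \<exists>y\<in>J. to_fract b * y \<notin> to_fract ` M"
    if "finite F" "\<And>M. M \<in> F \<Longrightarrow> is_maximal_ideal M" for F
    using that
  proof (induction F)
    case empty
    then show ?case using I by (auto simp: is_ideal_iff)
  next
    case (insert M F)
    then obtain b where b: "b \<in> I" "\<forall>N\<in>F. \<exists>y\<in>J. to_fract b * y \<notin> to_fract ` N"
      by auto
    show ?case
    proof (cases "\<exists>y\<in>J. to_fract b * y \<notin> to_fract ` M")
      case True
      with b show ?thesis by blast
    next
      case False
      have M: "is_maximal_ideal M" "is_ideal M" "M \<noteq> UNIV"
        using insert.prems by (auto simp: is_maximal_ideal_def)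
      obtain e where e: "e \<notin> M" "\<forall>N\<in>F. e \<in> N"
        using maximal_ideals_avoid[of F M] insert M(1) by blast
      obtain x y where xy: "x \<in> I" "y \<in> J" "to_fract x * y \<notin> to_fract ` M"
        using IJ_proper M by blast
      \<comment> \<open>Modulo \<open>N\<close> in \<open>F\<close>, the term \<open>e * x\<close>
        contributes nothing, as \<open>e\<close> is in \<open>N\<close>, so \<open>c\<close> is as
        good as \<open>b\<close> there. Modulo \<open>M\<close>, it is \<open>b\<close> that
        contributes nothing, while \<open>e * x\<close> times \<open>y\<close> survives because
        \<open>M\<close> is prime.\<close>
      define c where "c = b + e * x"
      \<comment> \<open>All products with \<open>z\<close> are elements of \<open>R\<close>, so
        membership in a maximal ideal can be tested on \<open>r\<close> and
        \<open>s\<close>.\<close>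
      have split: "\<exists>r s. to_fract b * z = to_fract r \<and> to_fract x * z = to_fract s
          \<and> to_fract c * z = to_fract (r + e * s)" if z: "z \<in> J" for z
      proof -
        obtain r s where "to_fract b * z = to_fract r" "to_fract x * z = to_fract s"
          using IJ b(1) xy(1) z by blast
        moreover from this have "to_fract c * z = to_fract (r + e * s)"
          by (simp add: c_def distrib_right mult.assoc)
        ultimately show ?thesis by blast
      qed
      have "c \<in> I" unfolding c_def using b(1) xy(1) I unfolding is_ideal_iff by blast
      moreover have "\<exists>z\<in>J. to_fract c * z \<notin> to_fract ` M"
      proof -
        obtain r s where rs: "to_fract b * y = to_fract r" "to_fract x * y = to_fract s"
          "to_fract c * y = to_fract (r + e * s)" using split xy(2) by blast
        have "r \<in> M" using False xy(2) rs(1) by auto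
        moreover have "e * s \<notin> M"
          using maximal_ideal_prime[OF M(1)] e(1) xy(3) rs(2) by auto
        ultimately have "r + e * s \<notin> M" using is_ideal_diff[OF M(2)] by force
        then have "to_fract c * y \<notin> to_fract ` M" unfolding rs(3) by (auto simp del: to_fract_add to_fract_mult)
        then show ?thesis using xy(2) by blast
      qed
      moreover have "\<exists>z\<in>J. to_fract c * z \<notin> to_fract ` N" if N: "N \<in> F" for N
      proof -
        obtain z where z: "z \<in> J" "to_fract b * z \<notin> to_fract ` N" using b(2) N by blast
        obtain r s where rs: "to_fract b * z = to_fract r"
          "to_fract c * z = to_fract (r + e * s)" using split z(1) by blast
        have ideal: "is_ideal N" using insert.prems N by (simp add: is_maximal_ideal_def)
        have "e * s \<in> N" using e(2) N ideal unfolding is_ideal_iff by (metis mult.commute)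
        moreover have "r \<notin> N" using z(2) rs(1) by auto
        ultimately have "r + e * s \<notin> N" using is_ideal_diff[OF ideal] by force
        then have "to_fract c * z \<notin> to_fract ` N" unfolding rs(2) by (auto simp del: to_fract_add to_fract_mult)
        then show ?thesis using z(1) by blast
      qed
      ultimately show ?thesis by blast
    qed
  qed
  from this[OF fin] obtain b where b: "b \<in> I"
    and b_gen: "\<And>M. is_maximal_ideal M \<Longrightarrow> I \<subseteq> M \<Longrightarrow> \<exists>y\<in>J. to_fract b * y \<notin> to_fract ` M"
    by blast

  \<comment> \<open>The fractional ideal bJ viewed as an ideal of \<open>R\<close>; as
    \<open>b\<close> is in \<open>I\<close>, bJ lies in \<open>R\<close> and nothing is
    lost.\<close>
  define L where "L = {r. \<exists>y\<in>J. to_fract r = to_fract b * y}"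
  have L: "is_ideal L"
    unfolding is_ideal_iff
  proof (intro conjI ballI allI)
    show "0 \<in> L" unfolding L_def using J0 by force
    show "u + v \<in> L" if "u \<in> L" "v \<in> L" for u v
      using that J_add unfolding L_def by (auto simp flip: distrib_left)
    show "r * u \<in> L" if "u \<in> L" for r u
      using that J_scale[of _ r] unfolding L_def by (force simp: mult.left_commute)
  qed
  \<comment> \<open>For r = by with \<open>y\<close> in \<open>J\<close>, the product xr is b(xy),
    and xy lies in \<open>R\<close>.\<close>
  have IL: "x * r \<in> range ((*) b)" if "x \<in> I" "r \<in> L" for x r
  proof -
    obtain y where y: "y \<in> J" "to_fract r = to_fract b * y" using \<open>r \<in> L\<close> unfolding L_def by blast
    obtain s where s: "to_fract x * y = to_fract s" using IJ \<open>x \<in> I\<close> y(1) by blast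
    have "to_fract (x * r) = to_fract b * (to_fract x * y)" by (simp add: y(2) mult_ac)
    also have "\<dots> = to_fract (b * s)" by (simp add: s)
    finally show ?thesis by (metis rangeI to_fract_eq_iff)
  qed

  define K where "K = {x + y |x y. x \<in> I \<and> y \<in> L}"
  \<comment> \<open>A maximal ideal above I + L would contain \<open>I\<close>, so by the choice of
    \<open>b\<close> some element of bJ lies outside it; but that element belongs to
    \<open>L\<close>.\<close>
  have "K = UNIV"
  proof (rule ccontr)
    assume "K \<noteq> UNIV"
    then obtain M where M: "is_maximal_ideal M" "K \<subseteq> M"
      using exists_maximal_ideal is_ideal_sum[OF I L] unfolding K_def by blast
    have "0 \<in> I" "0 \<in> L" using I L by (auto simp: is_ideal_iff)
    then have "I \<subseteq> K" "L \<subseteq> K" unfolding K_def by force+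
    then obtain y where y: "y \<in> J" "to_fract b * y \<notin> to_fract ` M" using b_gen M by blast
    then obtain r where "to_fract b * y = to_fract r" using IJ b by blast
    with y have "r \<in> L" "r \<notin> M" unfolding L_def by (force, auto)
    with \<open>L \<subseteq> K\<close> M(2) show False by blast
  qed
  then have "1 \<in> K" by simp
  then obtain a r where ar: "a \<in> I" "r \<in> L" "1 = a + r" unfolding K_def by blast
  then have r: "r = 1 - a" by (simp add: algebra_simps)

  have "idempotent_pair a b"
    using IL[OF ar(1,2)] by (simp add: idempotent_pair_def r)
  moreover have "I = ideal_generated {a, b}"
  proof
    show "I \<subseteq> ideal_generated {a, b}"
    proof
      fix x assume "x \<in> I"
      \<comment> \<open>Split x = xa + x(1 - a); the second summand is in IL and hence a multiple of
        \<open>b\<close>.\<close>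
      then obtain s where "x * r = b * s" using IL ar(2) by blast
      then have "x = x * a + s * b" unfolding r by (simp add: algebra_simps)
      then show "x \<in> ideal_generated {a, b}" unfolding ideal_generated_pair by blast
    qed
    show "ideal_generated {a, b} \<subseteq> I"
      unfolding ideal_generated_pair using I ar(1) b unfolding is_ideal_iff by blast
  qed
  ultimately show ?thesis by blast
qed

end
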